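(* Let $S$ be an ordered abelian semigroup and let $\lambda\in\mathbb{Q}$. Then the mixable shuffle algebra $\mathrm{MS}_{\mathbb{Q},\lambda}(S)$ is isomorphic (as a $\mathbb{Q}$-algebra) to the polynomial algebra $\mathbb{Q}[\mathrm{Lyn}(S)]$ on the set $\mathrm{Lyn}(S)$ of Lyndon words on $S$.
   Context: An ordered semigroup is a semigroup whose underlying set carries a total order $<$. Mixable shuffle algebra: let $\mathbf{k}$ be a commutative ring, $\lambda\in\mathbf{k}$, and $A$ a commutative, not necessarily unital, $\mathbf{k}$-algebra. Then $\mathrm{MS}_{\mathbf{k},\lambda}(A)=\bigoplus_{n\ge 0}A^{\otimes n}$ (with $A^{\otimes 0}=\mathbf{k}$), with the $\mathbf{k}$-bilinear product $\diamond=\diamond_\lambda$ for which $1\in\mathbf{k}$ is the identity and, for pure tensors $\mathfrak{a}=a_1\otimes\mathfrak{a}'$, $\mathfrak{b}=b_1\otimes\mathfrak{b}'$ of lengths $\ge 1$ (where $\mathfrak{a}',\mathfrak{b}'$ may be $1\in\mathbf{k}$, and $a\otimes 1$ is read as $a$), $$\mathfrak{a}\diamond\mathfrak{b}=a_1\otimes(\mathfrak{a}'\diamond\mathfrak{b})+b_1\otimes(\mathfrak{a}\diamond\mathfrak{b}')+\lambda\,(a_1b_1)\otimes(\mathfrak{a}'\diamond\mathfrak{b}').$$ This is a commutative unital $\mathbf{k}$-algebra. For an abelian semigroup $S$, $\mathrm{MS}_{\mathbf{k},\lambda}(S):=\mathrm{MS}_{\mathbf{k},\lambda}(\mathbf{k}S)$,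 with $\mathbf{k}S$ the semigroup algebra; as a module it is free on the set of words $M^{\otimes}(S)=\{1\}\cup\{u_1\otimes\cdots\otimes u_r\mid u_i\in S,\ r\ge1\}$. Lexicographic order on $M^{\otimes}(S)$: $u<v$ iff either $v=u\otimes x$ for a non-empty word $x$, or $u=x\otimes a\otimes u'$, $v=x\otimes b\otimes v'$ with words $x,u',v'$ and letters $a<b$. A Lyndon word is a non-empty word $w$ such that $w=u\otimes v$ with $u,v\ne1$ implies $w<v$ lexicographically. $\mathrm{Lyn}(S)$ is the set of Lyndon words. *)

theory Defs
  imports Complex_Main "HOL-Library.Poly_Mapping"
begin

section \<open>Free modules and (bi)linear extension\<close>

text \<open>
  The free module over a commutative ring \<open>'k\<close> on a type \<open>'b\<close> is \<open>'b \<Rightarrow>\<^sub>0 'k\<close>; the basis vector of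
  \<open>b\<close> is \<open>Poly_Mapping.single b 1\<close>.
\<close>

definition scale :: "'k::comm_ring_1 \<Rightarrow> ('b \<Rightarrow>\<^sub>0 'k) \<Rightarrow> ('b \<Rightarrow>\<^sub>0 'k)" where
  "scale c x = Poly_Mapping.map (\<lambda>d. c * d) x"

definition lin_ext :: "('b \<Rightarrow> ('c \<Rightarrow>\<^sub>0 'k)) \<Rightarrow> ('b \<Rightarrow>\<^sub>0 'k::comm_ring_1) \<Rightarrow> ('c \<Rightarrow>\<^sub>0 'k)" where
  "lin_ext f x = (\<Sum>b\<in>Poly_Mapping.keys x. scale (Poly_Mapping.lookup x b) (f b))"

definition bilin_ext ::
  "('a \<Rightarrow> 'b \<Rightarrow> ('c \<Rightarrow>\<^sub>0 'k)) \<Rightarrow> ('a \<Rightarrow>\<^sub>0 'k::comm_ring_1) \<Rightarrow> ('b \<Rightarrow>\<^sub>0 'k) \<Rightarrow> ('c \<Rightarrow>\<^sub>0 'k)" where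
  "bilin_ext f x y = lin_ext (\<lambda>a. lin_ext (f a) y) x"

lemma lookup_scale [simp]: "Poly_Mapping.lookup (scale c x) b = c * Poly_Mapping.lookup x b"
  by (simp add: scale_def Poly_Mapping.map.rep_eq when_def)

lemma scale_simps:
  "scale c (x + y) = scale c x + scale c y" "scale c (scale d x) = scale (c * d) x"
  "scale (c + d) x = scale c x + scale d x" "scale 0 x = 0" "scale 1 x = x" "scale c 0 = 0"
  by (auto intro!: poly_mapping_eqI simp: lookup_add algebra_simps)

lemma scale_sum: "scale c (sum f A) = (\<Sum>a\<in>A. scale c (f a))"
  by (induction A rule: infinite_finite_induct) (auto simp: scale_simps)

lemma lin_ext_superset:
  assumes "finite A" "Poly_Mapping.keys x \<subseteq> A"
  shows "lin_ext f x = (\<Sum>b\<in>A. scale (Poly_Mapping.lookup x b) (f b))"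
  unfolding lin_ext_def
  by (rule sum.mono_neutral_left) (use assms in \<open>auto simp: in_keys_iff scale_simps\<close>)

lemma lin_ext_add: "lin_ext f (x + y) = lin_ext f x + lin_ext f y"
proof -
  have "Poly_Mapping.keys (x + y) \<subseteq> Poly_Mapping.keys x \<union> Poly_Mapping.keys y"
    by (rule Poly_Mapping.keys_add)
  then show ?thesis
    by (simp add: lin_ext_superset[where A = "Poly_Mapping.keys x \<union> Poly_Mapping.keys y"]
        lookup_add scale_simps sum.distrib)
qed

lemma lin_ext_scale: "lin_ext f (scale c x) = scale c (lin_ext f x)"
proof -
  have "Poly_Mapping.keys (scale c x) \<subseteq> Poly_Mapping.keys x"
    by (auto simp: in_keys_iff)
  then show ?thesis
    by (simp add: lin_ext_superset[where A = "Poly_Mapping.keys x"] scale_sum scale_simps)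
qed

lemma lin_ext_single [simp]: "lin_ext f (Poly_Mapping.single b c) = scale c (f b)"
  by (simp add: lin_ext_superset[where A = "{b}"])

lemma lin_ext_zero [simp]: "lin_ext f 0 = 0"
  by (simp add: lin_ext_def)

lemma lin_ext_fun_add: "lin_ext (\<lambda>b. f b + g b) x = lin_ext f x + lin_ext g x"
  by (simp add: lin_ext_def scale_simps sum.distrib)

lemma lin_ext_fun_scale: "lin_ext (\<lambda>b. scale c (f b)) x = scale c (lin_ext f x)"
  by (simp add: lin_ext_def scale_simps scale_sum mult.commute)

lemma bilin_ext_simps:
  "bilin_ext f (x + x') y = bilin_ext f x y + bilin_ext f x' y"
  "bilin_ext f x (y + y') = bilin_ext f x y + bilin_ext f x y'"
  "bilin_ext f (scale c x) y = scale c (bilin_ext f x y)"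
  "bilin_ext f x (scale c y) = scale c (bilin_ext f x y)"
  "bilin_ext f 0 y = 0" "bilin_ext f x 0 = 0"
  "bilin_ext f (Poly_Mapping.single a c) (Poly_Mapping.single b d) = scale (c * d) (f a b)"
  by (simp_all add: bilin_ext_def lin_ext_add lin_ext_scale lin_ext_fun_add lin_ext_fun_scale
      scale_simps) (simp_all add: lin_ext_def scale_simps mult.commute)

lemma poly_mapping_linear_induct [case_names zero basis add scale]:
  fixes x :: "'b \<Rightarrow>\<^sub>0 'k::comm_ring_1"
  assumes "P 0" "\<And>b. P (Poly_Mapping.single b 1)"
    and "\<And>x y. P x \<Longrightarrow> P y \<Longrightarrow> P (x + y)" "\<And>c x. P x \<Longrightarrow> P (scale c x)"
  shows "P x"
proof -
  have *: "P (Poly_Mapping.single b c)" for b c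
  proof -
    have "Poly_Mapping.single b c = scale c (Poly_Mapping.single b 1)"
      by (intro poly_mapping_eqI) (simp add: lookup_single when_def)
    with assms show ?thesis by metis
  qed
  have sums: "P (\<Sum>b\<in>A. Poly_Mapping.single b (Poly_Mapping.lookup x b))" if "finite A" for A
    using that by (induction A rule: finite_induct) (use * assms in auto)
  have "x = (\<Sum>b\<in>Poly_Mapping.keys x. Poly_Mapping.single b (Poly_Mapping.lookup x b))"
    by (rule poly_mapping_eqI)
       (simp add: lookup_sum lookup_single when_def in_keys_iff)
  then show ?thesis
    using sums[of "Poly_Mapping.keys x"] by simp
qed

section \<open>The mixable shuffle algebra of an abelian semigroup\<close>

text \<open>
  The semigroup algebra of \<open>'a\<close> is \<open>'a \<Rightarrow>\<^sub>0 'k\<close> with product \<open>sg_mult\<close>. As \<open>'a\<close> is a basis of it, the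
  direct sum of all its tensor powers has the words \<open>u\<^sub>1 \<otimes> \<dots> \<otimes> u\<^sub>r\<close>, i.e. the lists
  \<open>[u\<^sub>1, \<dots>, u\<^sub>r]\<close>, as a basis and is represented by \<open>'a list \<Rightarrow>\<^sub>0 'k\<close>; the empty word spans the
  tensor power of length zero. The operation \<open>tensor\<close> maps an element of the algebra and an element
  of the direct sum to their tensor product.
\<close>

definition sg_mult ::
  "('a::ab_semigroup_mult \<Rightarrow>\<^sub>0 'k::comm_ring_1) \<Rightarrow> ('a \<Rightarrow>\<^sub>0 'k) \<Rightarrow> ('a \<Rightarrow>\<^sub>0 'k)" where
  "sg_mult = bilin_ext (\<lambda>a b. Poly_Mapping.single (a * b) 1)"

definition tensor ::
  "('a \<Rightarrow>\<^sub>0 'k::comm_ring_1) \<Rightarrow> ('a list \<Rightarrow>\<^sub>0 'k) \<Rightarrow> ('a list \<Rightarrow>\<^sub>0 'k)" where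
  "tensor = bilin_ext (\<lambda>a w. Poly_Mapping.single (a # w) 1)"

fun ms_words ::
  "'k::comm_ring_1 \<Rightarrow> 'a::ab_semigroup_mult list \<Rightarrow> 'a list \<Rightarrow> ('a list \<Rightarrow>\<^sub>0 'k)" where
  "ms_words l [] v = Poly_Mapping.single v 1"
| "ms_words l (a # u) [] = Poly_Mapping.single (a # u) 1"
| "ms_words l (a # u) (b # v) =
     tensor (Poly_Mapping.single a 1) (ms_words l u (b # v)) +
     tensor (Poly_Mapping.single b 1) (ms_words l (a # u) v) +
     scale l (tensor (Poly_Mapping.single (a * b) 1) (ms_words l u v))"

definition ms_mult ::
  "'k::comm_ring_1 \<Rightarrow> ('a::ab_semigroup_mult list \<Rightarrow>\<^sub>0 'k) \<Rightarrow> ('a list \<Rightarrow>\<^sub>0 'k) \<Rightarrow> ('a list \<Rightarrow>\<^sub>0 'k)" where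
  "ms_mult l = bilin_ext (ms_words l)"

definition ms_one :: "'a list \<Rightarrow>\<^sub>0 'k::comm_ring_1" where
  "ms_one = Poly_Mapping.single [] 1"

text \<open>
  The next three facts confirm that \<open>ms_mult\<close> is the mixable shuffle product: the recursion, imposed
  above on words only, holds for tensors of arbitrary elements \<open>a, b\<close> of the semigroup algebra.
\<close>

lemma ms_mult_one_left: "ms_mult l ms_one x = x"
  by (induction x rule: poly_mapping_linear_induct)
     (simp_all add: ms_mult_def ms_one_def bilin_ext_simps scale_simps)

lemma ms_mult_one_right: "ms_mult l x ms_one = x"
proof (induction x rule: poly_mapping_linear_induct)
  case (basis w)
  then show ?case
    by (cases w) (simp_all add: ms_mult_def ms_one_def bilin_ext_simps scale_simps)
qed (simp_all add: ms_mult_def bilin_ext_simps)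

lemma ms_mult_tensor:
  "ms_mult l (tensor a x) (tensor b y) =
     tensor a (ms_mult l x (tensor b y)) + tensor b (ms_mult l (tensor a x) y) +
     scale l (tensor (sg_mult a b) (ms_mult l x y))"
proof -
  note [simp] = ms_mult_def tensor_def sg_mult_def bilin_ext_simps scale_simps
  note [simp] = algebra_simps
  show ?thesis
  proof (induction a rule: poly_mapping_linear_induct)
    case (basis a)
    show ?case
    proof (induction x rule: poly_mapping_linear_induct)
      case (basis x)
      show ?case
      proof (induction b rule: poly_mapping_linear_induct)
        case (basis b)
        show ?case
          by (induction y rule: poly_mapping_linear_induct) simp_all
      qed simp_all
    qed simp_all
  qed simp_all
qed

section \<open>Lyndon words\<close>

text \<open>
  For \<open>r = {(a, b). a < b}\<close>, the library relation \<open>lexord r\<close> is the lexicographic order in which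
  proper prefixes are smaller.
\<close>

definition lyndon :: "'a::linorder list \<Rightarrow> bool" where
  "lyndon w \<longleftrightarrow> w \<noteq> [] \<and>
     (\<forall>u v. w = u @ v \<and> u \<noteq> [] \<and> v \<noteq> [] \<longrightarrow> (w, v) \<in> lexord {(a, b). a < b})"

typedef (overloaded) 'a lyndon_word = "{w :: 'a::linorder list. lyndon w}"
proof
  show "[undefined] \<in> {w :: 'a list. lyndon w}"
    by (auto simp: lyndon_def Cons_eq_append_conv)
qed

text \<open>
  The polynomial algebra \<open>'k[X]\<close> on a type \<open>'x\<close> of indeterminates is the library ring
  \<open>('x \<Rightarrow>\<^sub>0 nat) \<Rightarrow>\<^sub>0 'k\<close>: elements of \<open>'x \<Rightarrow>\<^sub>0 nat\<close> are the exponent vectors of monomials.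
\<close>

type_synonym ('x, 'k) polynomial_algebra = "('x \<Rightarrow>\<^sub>0 nat) \<Rightarrow>\<^sub>0 'k"

end

theory Submission
  imports Defs "HOL-Library.Multiset" "HOL-Library.List_Lexorder"
begin

text \<open>
  The idea is Radford's: the products of Lyndon words form a basis of the algebra, because each of
  them has a leading word from which it can be recovered.

  By Chen, Fox and Lyndon, every word is in exactly one way a concatenation
  \<open>x\<^sub>1 \<otimes> \<dots> \<otimes> x\<^sub>k\<close> of Lyndon words with \<open>x\<^sub>1 \<ge> \<dots> \<ge> x\<^sub>k\<close>; the reason is that the last factor has to
  be the smallest non-empty suffix. So concatenation in decreasing order is a bijection from the
  monomials in Lyndon words to the words (\<open>bij_betw_lyndon_concat\<close>).

  The mixable shuffle product of two words is the sum of their shuffles plus shorter words, since each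
  use of the term with \<open>\<lambda>\<close> merges two letters into one. So the product of the semigroup affects
  shorter words only, and in full length the product is the ordinary shuffle product. If \<open>x\<close> is at most
  every non-empty suffix of \<open>w\<close>, then \<open>w \<otimes> x\<close> is the largest shuffle of \<open>w\<close> and \<open>x\<close>
  (\<open>shuffle_le_append\<close>). Multiplying Lyndon words in decreasing order, one finds by induction that
  their product has their concatenation \<open>w\<close> as its leading word: \<open>w\<close> occurs with a positive
  coefficient, and all other words that occur are shorter than \<open>w\<close> or are lexicographically smaller
  anagrams of it (\<open>leading_word_ms_prod\<close>).

  The lexicographic order may fail to be well-founded, but a word has only finitely many anagrams, so
  comparing first lengths and then the ranks among the anagrams is well-founded. Evaluation of
  polynomials at the Lyndon words is thus a triangular linear map with non-zero diagonal, hence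
  bijective (\<open>bij_lin_ext_triangular\<close>). It is multiplicative because the mixable shuffle
  product is commutative and associative, and its inverse is the isomorphism.
\<close>

section \<open>The mixable shuffle product is commutative and associative\<close>

lemma lookup_tensor_single:
  "Poly_Mapping.lookup (tensor (Poly_Mapping.single a 1) x) w =
     (case w of [] \<Rightarrow> 0 | b # v \<Rightarrow> if a = b then Poly_Mapping.lookup x v else 0)"
  by (induction x rule: poly_mapping_linear_induct)
     (auto simp: tensor_def bilin_ext_simps scale_simps lookup_add lookup_single when_def
           split: list.splits)

lemma tensor_simps:
  "tensor a (x + y) = tensor a x + tensor a y" "tensor a (scale c x) = scale c (tensor a x)"
  by (simp_all add: tensor_def bilin_ext_simps)

lemma ms_mult_simps:
  "ms_mult l (x + x') y = ms_mult l x y + ms_mult l x' y"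
  "ms_mult l x (y + y') = ms_mult l x y + ms_mult l x y'"
  "ms_mult l (scale c x) y = scale c (ms_mult l x y)"
  "ms_mult l x (scale c y) = scale c (ms_mult l x y)"
  "ms_mult l 0 y = 0" "ms_mult l x 0 = 0"
  by (simp_all add: ms_mult_def bilin_ext_simps)

lemma ms_words_commute: "ms_words l u v = ms_words l v u"
proof (induction l u v rule: ms_words.induct)
  case (1 l v)
  then show ?case by (cases v) auto
qed (simp_all add: ac_simps)

lemma ms_mult_commute: "ms_mult l x y = ms_mult l y x"
proof (induction x rule: poly_mapping_linear_induct)
  case (basis u)
  show ?case
    by (induction y rule: poly_mapping_linear_induct)
       (simp_all add: ms_mult_simps, simp add: ms_mult_def bilin_ext_simps ms_words_commute)
qed (simp_all add: ms_mult_simps)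

lemma single_Cons:
  "Poly_Mapping.single (a # w) 1 = tensor (Poly_Mapping.single a 1) (Poly_Mapping.single w 1)"
  by (simp add: tensor_def bilin_ext_simps scale_simps)

lemma sg_mult_single:
  "sg_mult (Poly_Mapping.single a 1) (Poly_Mapping.single b 1) = Poly_Mapping.single (a * b) 1"
  by (simp add: sg_mult_def bilin_ext_simps scale_simps)

text \<open>
  Write the words as \<open>a \<otimes> u'\<close>, \<open>b \<otimes> v'\<close> and \<open>c \<otimes> w'\<close>. Expanding either side twice by the
  recursion yields the same seven terms, one for each way to form the first letter of the result:
  \<open>a\<close>, \<open>b\<close>, \<open>c\<close>, or a product of two or three of them. The rests of the terms differ only in their
  bracketing, so the claim follows by induction on the total length.
\<close>

lemma ms_mult_assoc_words:
  fixes l :: "'k::comm_ring_1"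
  defines "s \<equiv> \<lambda>w::'a::ab_semigroup_mult list. Poly_Mapping.single w (1::'k)"
  shows "ms_mult l (ms_mult l (s u) (s v)) (s w) = ms_mult l (s u) (ms_mult l (s v) (s w))"
proof (induction "length u + length v + length w" arbitrary: u v w rule: less_induct)
  case less
  show ?case
  proof (cases "u = [] \<or> v = [] \<or> w = []")
    case True
    then show ?thesis
      using ms_mult_one_left ms_mult_one_right unfolding s_def ms_one_def by metis
  next
    case False
    then obtain a u' b v' c w' where uvw: "u = a # u'" "v = b # v'" "w = c # w'"
      by (metis neq_Nil_conv)
    \<comment> \<open>Named operators keep the two expansions small: \<open>AB\<close> prepends the letter \<open>a * b\<close>, etc.\<close>
    define A where "A = tensor (Poly_Mapping.single a (1::'k))"
    define B where "B = tensor (Poly_Mapping.single b (1::'k))"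
    define C where "C = tensor (Poly_Mapping.single c (1::'k))"
    define AB where "AB = tensor (Poly_Mapping.single (a * b) (1::'k))"
    define AC where "AC = tensor (Poly_Mapping.single (a * c) (1::'k))"
    define BC where "BC = tensor (Poly_Mapping.single (b * c) (1::'k))"
    define ABC where "ABC = tensor (Poly_Mapping.single (a * b * c) (1::'k))"
    note defs = A_def B_def C_def AB_def AC_def BC_def ABC_def
    let ?m = "ms_mult l"
    have s: "s u = A (s u')" "s v = B (s v')" "s w = C (s w')"
      by (simp_all add: uvw s_def single_Cons A_def B_def C_def)
    have lin: "T (x + y) = T x + T y" "T (scale k x) = scale k (T x)"
      if "T \<in> {A, B, C, AB, AC, BC, ABC}" for T x y k
      using that by (auto simp: defs tensor_simps)
    note lin' = lin[of A] lin[of B] lin[of C] lin[of AB] lin[of AC] lin[of BC]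
    have rec:
      "?m (A x) (B y) = A (?m x (B y)) + B (?m (A x) y) + scale l (AB (?m x y))"
      "?m (A x) (C y) = A (?m x (C y)) + C (?m (A x) y) + scale l (AC (?m x y))"
      "?m (B x) (C y) = B (?m x (C y)) + C (?m (B x) y) + scale l (BC (?m x y))"
      "?m (AB x) (C y) = AB (?m x (C y)) + C (?m (AB x) y) + scale l (ABC (?m x y))"
      "?m (A x) (BC y) = A (?m x (BC y)) + BC (?m (A x) y) + scale l (ABC (?m x y))" for x y
      by (simp_all add: defs ms_mult_tensor sg_mult_single mult.assoc)
    have IH: "?m (?m (s u') (B (s v'))) (C (s w')) = ?m (s u') (?m (B (s v')) (C (s w')))"
      "?m (?m (A (s u')) (s v')) (C (s w')) = ?m (A (s u')) (?m (s v') (C (s w')))"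
      "?m (?m (A (s u')) (B (s v'))) (s w') = ?m (A (s u')) (?m (B (s v')) (s w'))"
      "?m (?m (s u') (s v')) (C (s w')) = ?m (s u') (?m (s v') (C (s w')))"
      "?m (?m (s u') (B (s v'))) (s w') = ?m (s u') (?m (B (s v')) (s w'))"
      "?m (?m (A (s u')) (s v')) (s w') = ?m (A (s u')) (?m (s v') (s w'))"
      "?m (?m (s u') (s v')) (s w') = ?m (s u') (?m (s v') (s w'))"
      using less[of u' v w] less[of u v' w] less[of u v w'] less[of u' v' w] less[of u' v w']
        less[of u v' w'] less[of u' v' w']
      by (simp_all flip: s) (simp_all add: uvw)
    have "?m (?m (s u) (s v)) (s w) =
        A (?m (?m (s u') (B (s v'))) (C (s w'))) + B (?m (?m (A (s u')) (s v')) (C (s w')))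
        + C (?m (?m (A (s u')) (B (s v'))) (s w'))
        + scale l (AB (?m (?m (s u') (s v')) (C (s w'))))
        + scale l (AC (?m (?m (s u') (B (s v'))) (s w')))
        + scale l (BC (?m (?m (A (s u')) (s v')) (s w')))
        + scale (l * l) (ABC (?m (?m (s u') (s v')) (s w')))"
      unfolding s by (simp add: rec ms_mult_simps lin' scale_simps algebra_simps)
    also have "\<dots> =
        A (?m (s u') (?m (B (s v')) (C (s w')))) + B (?m (A (s u')) (?m (s v') (C (s w'))))
        + C (?m (A (s u')) (?m (B (s v')) (s w')))
        + scale l (AB (?m (s u') (?m (s v') (C (s w')))))
        + scale l (AC (?m (s u') (?m (B (s v')) (s w'))))
        + scale l (BC (?m (A (s u')) (?m (s v') (s w'))))
        + scale (l * l) (ABC (?m (s u') (?m (s v') (s w'))))"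
      by (simp only: IH)
    also have "\<dots> = ?m (s u) (?m (s v) (s w))"
      unfolding s by (simp add: rec ms_mult_simps lin' scale_simps algebra_simps)
    finally show ?thesis .
  qed
qed

lemma ms_mult_assoc: "ms_mult l (ms_mult l x y) z = ms_mult l x (ms_mult l y z)"
proof (induction x rule: poly_mapping_linear_induct)
  case (basis u)
  show ?case
  proof (induction y rule: poly_mapping_linear_induct)
    case (basis v)
    show ?case
      by (induction z rule: poly_mapping_linear_induct)
         (simp_all add: ms_mult_simps ms_mult_assoc_words)
  qed (simp_all add: ms_mult_simps)
qed (simp_all add: ms_mult_simps)

text \<open>
  Products over multisets give a meaning to monomials without a choice of the order of the factors.
\<close>

global_interpretation ms_prod: comm_monoid_mset "ms_mult l" ms_one for l
  defines ms_prod = ms_prod.F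
  by standard (rule ms_mult_assoc, rule ms_mult_commute, rule ms_mult_one_right)

section \<open>Lyndon factorisations\<close>

lemma lyndon_le_suffix:
  assumes "lyndon w" "w = u @ v" "v \<noteq> []"
  shows "w \<le> v"
  using assms by (cases "u = []") (auto simp: lyndon_def list_le_def list_less_def)

lemma list_le_append: "u \<le> (u @ v :: 'a::linorder list)"
  by (induction u) auto

lemma append_le_append_iff: "w @ u \<le> w @ v \<longleftrightarrow> u \<le> (v :: 'a::linorder list)"
  by (induction w) auto

lemma prefix_if_between:
  fixes u w :: "'a::linorder list"
  assumes "\<not> u \<le> w" "u \<le> w @ v"
  shows "\<exists>r. u = w @ r"
  using assms
proof (induction w arbitrary: u)
  case (Cons c w)
  then show ?case by (cases u) auto
qed auto

text \<open>
  A non-empty suffix of a concatenation of Lyndon words starts with a non-empty suffix of one of the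
  factors, and the latter is at least that factor because the factor is Lyndon. The list \<open>ys\<close> holds
  the factors from right to left, so that an induction on lists splits off the last factor.
\<close>

lemma last_factor_le_suffix:
  fixes x :: "'a::linorder list"
  assumes "\<And>y. y \<in> set ys \<Longrightarrow> lyndon y \<and> x \<le> y" "concat (rev ys) = u @ v" "v \<noteq> []"
  shows "x \<le> v"
  using assms
proof (induction ys arbitrary: v)
  case (Cons y ys)
  have le: "x \<le> y" "lyndon y"
    using Cons.prems(1)[of y] by auto
  obtain r where "concat (rev ys) @ r = u \<and> y = r @ v \<or> concat (rev ys) = u @ r \<and> r @ y = v"
    using Cons.prems(2) by (auto simp: append_eq_append_conv2)
  then consider (inner) "y = r @ v" | (outer) "concat (rev ys) = u @ r" "v = r @ y"
    by auto
  then show ?case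
  proof cases
    case inner
    then show ?thesis
      using lyndon_le_suffix[of y r v] le Cons.prems(3) by auto
  next
    case outer
    show ?thesis
    proof (cases "r = []")
      case False
      then have "x \<le> r"
        using Cons.IH[of r] Cons.prems(1) outer by auto
      then show ?thesis
        using list_le_append[of r y] outer by auto
    qed (use outer le in auto)
  qed
qed auto

text \<open>
  Either candidate is the smallest non-empty suffix of the word.
\<close>

lemma last_factor_unique:
  fixes x y :: "'a::linorder list"
  assumes "concat (rev xs) @ x = concat (rev ys) @ y"
    and "\<And>z. z \<in> set (x # xs) \<Longrightarrow> lyndon z \<and> x \<le> z"
    and "\<And>z. z \<in> set (y # ys) \<Longrightarrow> lyndon z \<and> y \<le> z"
  shows "x = y"
proof -
  have "x \<noteq> []" "y \<noteq> []"
    using assms(2)[of x] assms(3)[of y] by (auto simp: lyndon_def)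
  then have "x \<le> y" "y \<le> x"
    using last_factor_le_suffix[of "x # xs" x "concat (rev ys)" y]
      last_factor_le_suffix[of "y # ys" y "concat (rev xs)" x] assms by auto
  then show ?thesis by simp
qed

lemma lyndon_factorisation_unique:
  fixes xs ys :: "'a::linorder list list"
  assumes "sorted xs" "sorted ys" "\<forall>x \<in> set xs. lyndon x" "\<forall>y \<in> set ys. lyndon y"
    and "concat (rev xs) = concat (rev ys)"
  shows "xs = ys"
  using assms
proof (induction xs arbitrary: ys)
  case Nil
  then show ?case by (cases ys) (auto simp: lyndon_def)
next
  case (Cons x xs)
  have "ys \<noteq> []"
    using Cons.prems(3,5) by (auto simp: lyndon_def)
  then obtain y ys' where ys: "ys = y # ys'"
    by (cases ys) auto
  have "x = y"
  proof (rule last_factor_unique)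
    show "concat (rev xs) @ x = concat (rev ys') @ y"
      using Cons.prems(5) by (simp add: ys)
    show "lyndon z \<and> x \<le> z" if "z \<in> set (x # xs)" for z
      using Cons.prems(1,3) that by auto
    show "lyndon z \<and> y \<le> z" if "z \<in> set (y # ys')" for z
      using Cons.prems(2,4) that by (auto simp: ys)
  qed
  then show ?case
    using Cons.IH[of ys'] Cons.prems by (auto simp: ys)
qed

text \<open>
  Split off the smallest non-empty suffix \<open>x\<close>, which is Lyndon, and factorise the rest. The order of
  the factors is right: if \<open>z\<close> is the factor before \<open>x\<close>, then \<open>x \<le> z \<otimes> x\<close>, as \<open>z \<otimes> x\<close> is a
  suffix, too. If \<open>z < x\<close>, this forces \<open>x = z \<otimes> r\<close> and then \<open>r \<le> x\<close>, although the proper suffix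
  \<open>r\<close> of the Lyndon word \<open>x\<close> is larger than \<open>x\<close>.
\<close>

lemma lyndon_factorisation_exists:
  fixes w :: "'a::linorder list"
  shows "\<exists>xs. sorted xs \<and> (\<forall>x \<in> set xs. lyndon x) \<and> concat (rev xs) = w"
proof (induction "length w" arbitrary: w rule: less_induct)
  case less
  show ?case
  proof (cases "w = []")
    case True
    then show ?thesis by (intro exI[of _ "[]"]) auto
  next
    case False
    define Suf where "Suf = {v. v \<noteq> [] \<and> (\<exists>u. w = u @ v)}"
    have "Suf \<subseteq> (\<lambda>n. drop n w) ` {..length w}"
    proof
      fix v
      assume "v \<in> Suf"
      then obtain u where "w = u @ v"
        by (auto simp: Suf_def)
      then show "v \<in> (\<lambda>n. drop n w) ` {..length w}"
        by (intro image_eqI[of _ _ "length u"]) auto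
    qed
    then have fin: "finite Suf"
      using finite_surj by blast
    have "Suf \<noteq> {}"
      using False by (auto simp: Suf_def)
    define x where "x = Min Suf"
    have "x \<in> Suf" and x_le: "\<And>v. v \<in> Suf \<Longrightarrow> x \<le> v"
      using fin \<open>Suf \<noteq> {}\<close> by (auto simp: x_def)
    then obtain w' where w': "w = w' @ x" "x \<noteq> []"
      by (auto simp: Suf_def)
    have x_less: "x < v" if "x = u @ v" "u \<noteq> []" "v \<noteq> []" for u v
    proof -
      have "v \<in> Suf"
        using that w' by (auto simp: Suf_def)
      then show ?thesis
        using x_le[of v] that by (auto simp: order_le_less)
    qed
    then have lyn: "lyndon x"
      using w'(2) by (auto simp: lyndon_def list_less_def)
    obtain xs where xs: "sorted xs" "\<forall>x \<in> set xs. lyndon x" "concat (rev xs) = w'"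
      using less[of w'] w' by auto
    have "x \<le> y" if y: "y \<in> set xs" for y
    proof -
      obtain z zs where zs: "xs = z # zs"
        using y by (cases xs) auto
      have "x \<le> z"
      proof (rule ccontr)
        assume "\<not> x \<le> z"
        have "z @ x \<in> Suf"
          using xs(3) w' by (auto simp: Suf_def zs)
        then have "x \<le> z @ x"
          by (rule x_le)
        then obtain r where r: "x = z @ r"
          using prefix_if_between \<open>\<not> x \<le> z\<close> by blast
        then have "r \<noteq> []" "z \<noteq> []"
          using \<open>\<not> x \<le> z\<close> xs(2) by (auto simp: zs lyndon_def)
        then have "x < r"
          using x_less r by blast
        moreover have "r \<le> x"
          using \<open>x \<le> z @ x\<close> append_le_append_iff[of z r x] by (simp flip: r)
        ultimately show False by simp
      qed
      then show ?thesis
        using that xs(1) by (auto simp: zs)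
    qed
    then show ?thesis
      using xs lyn w' by (intro exI[of _ "x # xs"]) auto
  qed
qed

definition lyndon_concat :: "'a::linorder list multiset \<Rightarrow> 'a list" where
  "lyndon_concat M = concat (rev (sorted_list_of_multiset M))"

lemma bij_betw_lyndon_concat:
  "bij_betw lyndon_concat {M :: 'a::linorder list multiset. \<forall>x \<in># M. lyndon x} UNIV"
proof (rule bij_betw_imageI)
  show "inj_on lyndon_concat {M :: 'a list multiset. \<forall>x \<in># M. lyndon x}"
  proof (rule inj_onI)
    fix M N :: "'a list multiset"
    assume "M \<in> {M. \<forall>x \<in># M. lyndon x}" "N \<in> {M. \<forall>x \<in># M. lyndon x}"
      "lyndon_concat M = lyndon_concat N"
    then have "sorted_list_of_multiset M = sorted_list_of_multiset N"
      by (intro lyndon_factorisation_unique) (auto simp: lyndon_concat_def)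
    then show "M = N"
      by (metis mset_sorted_list_of_multiset)
  qed
  show "lyndon_concat ` {M :: 'a list multiset. \<forall>x \<in># M. lyndon x} = UNIV"
  proof safe
    fix w :: "'a list"
    obtain xs where xs: "sorted xs" "\<forall>x \<in> set xs. lyndon x" "concat (rev xs) = w"
      using lyndon_factorisation_exists by blast
    then have "lyndon_concat (mset xs) = w"
      by (simp add: lyndon_concat_def sorted_list_of_multiset_mset sorted_sort_id)
    then show "w \<in> lyndon_concat ` {M. \<forall>x \<in># M. lyndon x}"
      using xs by (intro image_eqI[of _ _ "mset xs"]) auto
  qed simp
qed

section \<open>The largest shuffle\<close>

lemma shuffles_Nil2 [simp]: "shuffles xs [] = {xs}"
  by (cases xs) auto

lemma append_in_shuffles: "u @ v \<in> shuffles u v"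
  by (induction u) (auto intro: Cons_in_shuffles_leftI)

lemma mset_shuffles: "t \<in> shuffles u v \<Longrightarrow> mset t = mset u + mset v"
  by (induction u v arbitrary: t rule: shuffles.induct) auto

text \<open>
  Put the letters of \<open>v\<close> at the places that those of \<open>u\<close> take in \<open>t\<close>; the first difference arises
  where \<open>u\<close> and \<open>v\<close> first differ.
\<close>

lemma shuffles_mono:
  fixes u v :: "'a::linorder list"
  assumes "t \<in> shuffles u w" "u \<le> v" "length u = length v"
  shows "\<exists>t' \<in> shuffles v w. t \<le> t'"
  using assms
proof (induction u w arbitrary: t v rule: shuffles.induct)
  case (3 a u b w)
  obtain c v' where v: "v = c # v'"
    using "3.prems" by (cases v) auto
  from "3.prems"(1) consider
      (left) t' where "t = a # t'" "t' \<in> shuffles u (b # w)"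
    | (right) t' where "t = b # t'" "t' \<in> shuffles (a # u) w"
    by auto
  then show ?case
  proof cases
    case left
    consider "a < c" | "a = c" "u \<le> v'"
      using "3.prems"(2) by (auto simp: v)
    then show ?thesis
    proof cases
      case 1
      then show ?thesis
        using left append_in_shuffles[of v "b # w"] by (intro bexI[of _ "v @ b # w"]) (auto simp: v)
    next
      case 2
      then obtain t'' where "t'' \<in> shuffles v' (b # w)" "t' \<le> t''"
        using "3.IH"(1)[of t' v'] left "3.prems" by (auto simp: v)
      then show ?thesis
        using left 2 by (intro bexI[of _ "c # t''"]) (auto simp: v)
    qed
  next
    case right
    then obtain t'' where "t'' \<in> shuffles v w" "t' \<le> t''"
      using "3.IH"(2)[of t' v] "3.prems" by auto
    then show ?thesis
      using right by (intro bexI[of _ "b # t''"]) (auto simp: v)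
  qed
qed auto

text \<open>
  A block \<open>x\<close> in front of the larger of two words may be moved in front of the smaller one without
  making the largest shuffle smaller. In the induction the block grows: if \<open>t\<close> starts with the first
  letter of \<open>v\<close> and \<open>u\<close> starts with the same letter, then that letter is taken from \<open>u\<close> on the new
  side, and its copy in \<open>u\<close> on the old side joins the block.
\<close>

lemma shuffles_exchange:
  fixes u v :: "'a::linorder list"
  assumes "t \<in> shuffles (x @ u) v" "v \<le> u"
  shows "\<exists>t' \<in> shuffles u (x @ v). t \<le> t'"
  using assms
proof (induction "length x + length u + length v" arbitrary: x u v t rule: less_induct)
  case less
  show ?case
  proof (cases "x = [] \<or> v = []")
    case True
    then show ?thesis
      using less.prems append_in_shuffles[of x u] by (auto simp: shuffles_commutes)
  next
    case False
    then obtain c x' e v' where xv: "x = c # x'" "v = e # v'"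
      by (metis neq_Nil_conv)
    then obtain f u' where u: "u = f # u'"
      using less.prems(2) by (cases u) auto
    from less.prems(1) consider
        (left) t' where "t = c # t'" "t' \<in> shuffles (x' @ u) v"
      | (right) t' where "t = e # t'" "t' \<in> shuffles (x @ u) v'"
      by (auto simp: xv)
    then show ?thesis
    proof cases
      case left
      then obtain t'' where "t'' \<in> shuffles u (x' @ v)" "t' \<le> t''"
        using less.hyps[of x' u v t'] less.prems by (auto simp: xv)
      then show ?thesis
        using left by (intro bexI[of _ "c # t''"]) (auto simp: xv intro: Cons_in_shuffles_rightI)
    next
      case right
      consider "e < f" | "e = f" "v' \<le> u'"
        using less.prems(2) by (auto simp: xv u)
      then show ?thesis
      proof cases
        case 1
        then show ?thesis
          using right append_in_shuffles[of u "x @ v"]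
          by (intro bexI[of _ "u @ x @ v"]) (auto simp: u)
      next
        case 2
        then obtain t'' where "t'' \<in> shuffles u' (x @ v)" "t' \<le> t''"
          using less.hyps[of "x @ [e]" u' v' t'] right by (auto simp: xv u)
        then show ?thesis
          using right 2
          by (intro bexI[of _ "e # t''"]) (auto simp: u intro: Cons_in_shuffles_leftI)
      qed
    qed
  qed
qed

text \<open>
  A largest shuffle may take its next letter from the larger of the two remaining words, which is
  \<open>w\<close>, as \<open>w\<close> is a suffix of itself. A shuffle that takes a letter \<open>c\<close> from \<open>x\<close> instead is
  smaller at once, or \<open>w\<close> starts with \<open>c\<close>, too; in the second case \<open>shuffles_exchange\<close> with the
  block \<open>[c]\<close> gives a shuffle at least as large that takes \<open>c\<close> from \<open>w\<close>.
\<close>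

lemma shuffle_le_append:
  fixes w x :: "'a::linorder list"
  assumes "t \<in> shuffles w x" "\<And>u v. w = u @ v \<Longrightarrow> v \<noteq> [] \<Longrightarrow> x \<le> v"
  shows "t \<le> w @ x"
  using assms
proof (induction w arbitrary: t)
  case (Cons d w)
  have suffix: "x \<le> v" if "w = u @ v" "v \<noteq> []" for u v
    using Cons.prems(2)[of "d # u" v] that by auto
  show ?case
  proof (cases x)
    case Nil
    then show ?thesis using Cons.prems by auto
  next
    case x: (Cons c x')
    from Cons.prems(1) consider
        (left) t' where "t = d # t'" "t' \<in> shuffles w x"
      | (right) t' where "t = c # t'" "t' \<in> shuffles (d # w) x'"
      by (auto simp: x)
    then show ?thesis
    proof cases
      case left
      then show ?thesis using Cons.IH suffix by auto
    next
      case right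
      consider "c < d" | "c = d" "x' \<le> w"
        using Cons.prems(2)[of "[]" "d # w"] by (auto simp: x)
      then show ?thesis
      proof cases
        case 2
        then obtain t'' where t'': "t'' \<in> shuffles w x" "t' \<le> t''"
          using shuffles_exchange[of t' "[d]" w x'] right by (auto simp: x)
        then have "t'' \<le> w @ x"
          using Cons.IH suffix by blast
        then show ?thesis
          using t'' right 2 by auto
      qed (use right in auto)
    qed
  qed
qed auto

section \<open>Leading words of products of Lyndon words\<close>

text \<open>
  The term with \<open>l\<close> has one letter less than the other two, so it contributes only to words \<open>t\<close>
  below full length; what remains counts shuffles, with multiplicities that are positive integers.
\<close>

lemma lookup_ms_words:
  fixes l :: "'k::linordered_idom"
  assumes "length u + length v \<le> length t"
  shows "if t \<in> shuffles u v then 0 < Poly_Mapping.lookup (ms_words l u v) t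
         else Poly_Mapping.lookup (ms_words l u v) t = 0"
  using assms
proof (induction l u v arbitrary: t rule: ms_words.induct)
  case (3 l a u b v)
  then obtain c t' where t: "t = c # t'"
    by (cases t) auto
  have "t' \<notin> shuffles u v"
    using 3(4) length_shuffles[of t' u v] by (auto simp: t)
  then have 0: "Poly_Mapping.lookup (ms_words l u v) t' = 0"
    using 3(3)[of t'] 3(4) by (auto simp: t)
  then show ?case
    using 3(1)[of t'] 3(2)[of t'] 3(4)
    by (auto simp: t lookup_add lookup_tensor_single split: if_splits)
qed (auto simp: lookup_single when_def)

text \<open>
  Positivity of all coefficients in full length, not only of the leading one, excludes cancellation
  when such elements are multiplied.
\<close>

definition leading_word :: "'a::linorder list \<Rightarrow> ('a list \<Rightarrow>\<^sub>0 'k::linordered_idom) \<Rightarrow> bool" where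
  "leading_word w p \<longleftrightarrow> w \<in> Poly_Mapping.keys p \<and>
     (\<forall>u \<in> Poly_Mapping.keys p. length u < length w \<or>
        mset u = mset w \<and> u \<le> w \<and> 0 < Poly_Mapping.lookup p u)"

lemma lookup_lin_ext:
  "Poly_Mapping.lookup (lin_ext f x) w =
     (\<Sum>b \<in> Poly_Mapping.keys x. Poly_Mapping.lookup x b * Poly_Mapping.lookup (f b) w)"
  by (simp add: lin_ext_def lookup_sum)

lemma ms_mult_single_right: "ms_mult l p (Poly_Mapping.single x 1) = lin_ext (\<lambda>u. ms_words l u x) p"
  by (simp add: ms_mult_def bilin_ext_def scale_simps)

text \<open>
  A word of full length in the product is a shuffle of \<open>x\<close> with an anagram \<open>u \<le> w\<close> of \<open>w\<close>. By
  \<open>shuffles_mono\<close> it is at most some shuffle of \<open>x\<close> with \<open>w\<close>, hence at most \<open>w \<otimes> x\<close>.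
\<close>

lemma leading_word_ms_mult:
  fixes p :: "'a::{ab_semigroup_mult, linorder} list \<Rightarrow>\<^sub>0 'k::linordered_idom"
  assumes lead: "leading_word w p" and suffix: "\<And>u v. w = u @ v \<Longrightarrow> v \<noteq> [] \<Longrightarrow> x \<le> v"
  shows "leading_word (w @ x) (ms_mult l p (Poly_Mapping.single x 1))"
proof -
  let ?q = "ms_mult l p (Poly_Mapping.single x 1)"
  let ?c = "\<lambda>t u. Poly_Mapping.lookup p u * Poly_Mapping.lookup (ms_words l u x) t"
  have q: "Poly_Mapping.lookup ?q t = (\<Sum>u \<in> Poly_Mapping.keys p. ?c t u)" for t
    by (simp add: ms_mult_single_right lookup_lin_ext)
  have key: "length u < length w \<or> mset u = mset w \<and> u \<le> w \<and> 0 < Poly_Mapping.lookup p u"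
    if "u \<in> Poly_Mapping.keys p" for u
    using lead that by (auto simp: leading_word_def)
  have len: "length u \<le> length w" if "u \<in> Poly_Mapping.keys p" for u
    using key[OF that] mset_eq_length by fastforce
  have nonneg: "0 \<le> ?c t u"
    if "u \<in> Poly_Mapping.keys p" "length (w @ x) \<le> length t" for t u
    using key[OF that(1)]
  proof (elim disjE conjE)
    assume "length u < length w"
    then show ?thesis
      using lookup_ms_words[of u x t l] length_shuffles[of t u x] that(2)
      by (auto split: if_splits)
  next
    assume "0 < Poly_Mapping.lookup p u"
    then show ?thesis
      using lookup_ms_words[of u x t l] len[OF that(1)] that(2)
      by (auto split: if_splits)
  qed
  have top: "mset t = mset (w @ x) \<and> t \<le> w @ x"
    if t: "t \<in> Poly_Mapping.keys ?q" "length (w @ x) \<le> length t" for t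
  proof -
    obtain u where u: "u \<in> Poly_Mapping.keys p" "?c t u \<noteq> 0"
      using t(1) sum.not_neutral_contains_not_neutral[of "?c t" "Poly_Mapping.keys p"]
      by (auto simp: in_keys_iff q)
    then have t_in: "t \<in> shuffles u x"
      using lookup_ms_words[of u x t l] len[OF u(1)] t(2) by (auto split: if_splits)
    then have "length u = length w"
      using length_shuffles[OF t_in] len[OF u(1)] t(2) by auto
    then have uw: "mset u = mset w" "u \<le> w"
      using key[OF u(1)] by auto
    then obtain t' where "t' \<in> shuffles w x" "t \<le> t'"
      using shuffles_mono[OF t_in] \<open>length u = length w\<close> by auto
    then have "t \<le> w @ x"
      using shuffle_le_append[of t' w x] suffix by fastforce
    then show ?thesis
      using mset_shuffles[OF t_in] uw by simp
  qed
  have "w \<in> Poly_Mapping.keys p"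
    using lead by (simp add: leading_word_def)
  then have "0 < ?c (w @ x) w"
    using key[of w] lookup_ms_words[of w x "w @ x" l] append_in_shuffles[of w x] by auto
  then have "0 < Poly_Mapping.lookup ?q (w @ x)"
    unfolding q using nonneg[of _ "w @ x"] \<open>w \<in> Poly_Mapping.keys p\<close> by (intro sum_pos2) auto
  then have "w @ x \<in> Poly_Mapping.keys ?q"
    by (simp add: in_keys_iff)
  moreover have "0 < Poly_Mapping.lookup ?q t"
    if "t \<in> Poly_Mapping.keys ?q" "length (w @ x) \<le> length t" for t
  proof -
    have "0 \<le> Poly_Mapping.lookup ?q t"
      unfolding q using nonneg that(2) by (intro sum_nonneg) auto
    then show ?thesis
      using that(1) by (simp add: in_keys_iff)
  qed
  ultimately show ?thesis
    unfolding leading_word_def using top by (meson not_le)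
qed

lemma leading_word_ms_prod:
  fixes M :: "'a::{ab_semigroup_mult, linorder} list multiset" and l :: "'k::linordered_idom"
  assumes "\<And>x. x \<in># M \<Longrightarrow> lyndon x"
  shows "leading_word (lyndon_concat M)
           (ms_prod l (image_mset (\<lambda>x. Poly_Mapping.single x 1) M))"
proof -
  have "leading_word (concat (rev xs))
          (ms_prod l (image_mset (\<lambda>x. Poly_Mapping.single x 1) (mset xs)))"
    if "sorted xs" "\<forall>x \<in> set xs. lyndon x" for xs :: "'a list list"
    using that
  proof (induction xs)
    case Nil
    then show ?case by (auto simp: leading_word_def ms_one_def)
  next
    case (Cons x xs)
    have "leading_word (concat (rev xs) @ x)
            (ms_mult l (ms_prod l (image_mset (\<lambda>x. Poly_Mapping.single x 1) (mset xs)))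
              (Poly_Mapping.single x 1))"
      using Cons by (intro leading_word_ms_mult last_factor_le_suffix) auto
    then show ?case
      by (simp add: ms_mult_commute)
  qed
  from this[of "sorted_list_of_multiset M"] show ?thesis
    using assms by (auto simp: lyndon_concat_def)
qed

section \<open>Triangular linear maps\<close>

lemma lin_ext_diff: "lin_ext f (x - y) = lin_ext f x - lin_ext f (y :: 'b \<Rightarrow>\<^sub>0 'k::comm_ring_1)"
proof -
  have "lin_ext f x = lin_ext f ((x - y) + y)"
    by simp
  then show ?thesis
    unfolding lin_ext_add by simp
qed

text \<open>
  Injectivity: if \<open>f b\<close> is maximal among the leading basis vectors in a combination of the \<open>g b\<close>,
  no other summand contains it. Surjectivity: by well-founded induction every basis vector is a
  combination, as \<open>g b\<close> is a multiple of \<open>f b\<close> plus a combination of smaller basis vectors.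
\<close>

lemma bij_lin_ext_triangular:
  fixes g :: "'b \<Rightarrow> ('c \<Rightarrow>\<^sub>0 'k::field)"
  assumes "bij f" "wf r" "trans r"
    and diag: "\<And>b. Poly_Mapping.lookup (g b) (f b) \<noteq> 0"
    and below: "\<And>b c. c \<in> Poly_Mapping.keys (g b) \<Longrightarrow> c = f b \<or> (c, f b) \<in> r"
  shows "bij (lin_ext g)"
proof (rule bijI)
  have kernel: "x = 0" if "lin_ext g x = 0" for x
  proof (rule ccontr)
    assume "x \<noteq> 0"
    then have "Poly_Mapping.keys x \<noteq> {}"
      by simp
    moreover have "asymp_on (Poly_Mapping.keys x) (\<lambda>b b'. (f b, f b') \<in> r)"
      using \<open>wf r\<close> by (auto simp: asymp_on_def dest: wf_not_sym)
    moreover have "transp_on (Poly_Mapping.keys x) (\<lambda>b b'. (f b, f b') \<in> r)"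
      by (rule transp_onI) (rule transD[OF \<open>trans r\<close>])
    ultimately obtain b where b: "b \<in> Poly_Mapping.keys x"
      and max: "\<And>b'. b' \<in> Poly_Mapping.keys x \<Longrightarrow> b' \<noteq> b \<Longrightarrow> (f b, f b') \<notin> r"
      using Finite_Set.bex_max_element[of "Poly_Mapping.keys x" "\<lambda>b b'. (f b, f b') \<in> r"]
      by auto
    have off: "Poly_Mapping.lookup (g b') (f b) = 0"
      if "b' \<in> Poly_Mapping.keys x" "b' \<noteq> b" for b'
      using below[of "f b" b'] max[OF that]  that(2) \<open>bij f\<close>
      by (auto simp: in_keys_iff bij_def inj_eq)
    have "Poly_Mapping.lookup (lin_ext g x) (f b) =
        (\<Sum>b' \<in> Poly_Mapping.keys x. if b' = b then
           Poly_Mapping.lookup x b * Poly_Mapping.lookup (g b) (f b) else 0)"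
      unfolding lookup_lin_ext by (intro sum.cong) (auto simp: off)
    also have "\<dots> = Poly_Mapping.lookup x b * Poly_Mapping.lookup (g b) (f b)"
      using b by (simp add: sum.delta)
    also have "\<dots> \<noteq> 0"
      using b diag by (simp add: in_keys_iff)
    finally show False
      using that by simp
  qed
  show "inj (lin_ext g)"
  proof (rule injI)
    fix x y
    assume "lin_ext g x = lin_ext g y"
    then have "lin_ext g (x - y) = 0"
      by (simp add: lin_ext_diff)
    then show "x = y"
      using kernel by fastforce
  qed
  have combination: "x \<in> range (lin_ext g)"
    if "\<And>c. c \<in> Poly_Mapping.keys x \<Longrightarrow> Poly_Mapping.single c 1 \<in> range (lin_ext g)" for x
  proof -
    have "\<forall>c \<in> Poly_Mapping.keys x. \<exists>y. lin_ext g y = Poly_Mapping.single c 1"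
      using that by fastforce
    then obtain h where h: "\<forall>c \<in> Poly_Mapping.keys x. lin_ext g (h c) = Poly_Mapping.single c 1"
      by (rule bchoice[THEN exE])
    have "lin_ext g (lin_ext h x) = lin_ext (\<lambda>c. lin_ext g (h c)) x"
      by (induction x rule: poly_mapping_linear_induct)
         (simp_all add: lin_ext_add lin_ext_scale scale_simps)
    also have "\<dots> = lin_ext (\<lambda>c. Poly_Mapping.single c 1) x"
      unfolding lin_ext_def[of _ x] by (intro sum.cong) (simp_all add: h)
    also have "\<dots> = x"
      by (induction x rule: poly_mapping_linear_induct)
         (simp_all add: lin_ext_add lin_ext_scale scale_simps)
    finally show ?thesis
      by (intro range_eqI) (rule sym)
  qed
  have "Poly_Mapping.single c 1 \<in> range (lin_ext g)" for c
    using \<open>wf r\<close>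
  proof (induction c rule: wf_induct_rule)
    case (less c)
    obtain b where c: "c = f b"
      using \<open>bij f\<close> by (metis bij_pointE)
    define d where "d = Poly_Mapping.lookup (g b) c"
    have "d \<noteq> 0"
      using diag by (simp add: d_def c)
    define y where "y = g b - Poly_Mapping.single c d"
    have "c' \<noteq> c \<and> c' \<in> Poly_Mapping.keys (g b)" if "c' \<in> Poly_Mapping.keys y" for c'
      using that by (auto simp: y_def d_def in_keys_iff lookup_minus lookup_single when_def
            split: if_splits)
    then have "(c', c) \<in> r" if "c' \<in> Poly_Mapping.keys y" for c'
      using that below c by blast
    then obtain x where x: "y = lin_ext g x"
      using combination[of y] less by blast
    have "lin_ext g (scale (inverse d) (Poly_Mapping.single b 1 - x))
        = scale (inverse d) (g b - y)"
      by (simp add: lin_ext_scale lin_ext_diff scale_simps x)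
    also have "\<dots> = Poly_Mapping.single c 1"
      using \<open>d \<noteq> 0\<close> by (auto intro!: poly_mapping_eqI simp: y_def lookup_single when_def)
    finally show ?case
      by (intro range_eqI) (rule sym)
  qed
  then show "surj (lin_ext g)"
    using combination by blast
qed

section \<open>The isomorphism\<close>

text \<open>
  Lexicographic comparison of anagrams is turned into a comparison of numbers, so that its
  well-foundedness for an arbitrary totally ordered alphabet comes from that of \<open>nat\<close>.
\<close>

definition anagram_rank :: "'a::linorder list \<Rightarrow> nat" where
  "anagram_rank w = card {u. mset u = mset w \<and> u < w}"

lemma anagram_rank_less:
  assumes "mset u = mset w" "u < w"
  shows "anagram_rank u < anagram_rank w"
  unfolding anagram_rank_def
proof (rule psubset_card_mono)
  show "finite {v. mset v = mset w \<and> v < w}"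
    using mset_eq_finite[of w] by (rule rev_finite_subset) auto
qed (use assms in auto)

definition exponent_mset :: "('x \<Rightarrow>\<^sub>0 nat) \<Rightarrow> 'x multiset" where
  "exponent_mset m = Abs_multiset (Poly_Mapping.lookup m)"

lemma count_exponent_mset: "count (exponent_mset m) = Poly_Mapping.lookup m"
  using finite_lookup[of m] by (simp add: exponent_mset_def count_Abs_multiset)

lemma exponent_mset_add: "exponent_mset (m + n) = exponent_mset m + exponent_mset n"
  by (rule multiset_eqI) (simp add: count_exponent_mset lookup_add)

lemma exponent_mset_zero: "exponent_mset 0 = {#}"
  by (rule multiset_eqI) (simp add: count_exponent_mset)

lemma bij_exponent_mset: "bij exponent_mset"
proof (rule bijI)
  show "inj exponent_mset"
    by (intro injI poly_mapping_eqI) (metis count_exponent_mset)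
  have "exponent_mset (Abs_poly_mapping (count M)) = M" for M :: "'x multiset"
    by (rule multiset_eqI) (simp add: count_exponent_mset)
  then show "surj exponent_mset"
    by (rule surjI)
qed

definition lyndon_monomial :: "('a::linorder lyndon_word \<Rightarrow>\<^sub>0 nat) \<Rightarrow> 'a list multiset" where
  "lyndon_monomial m = image_mset Rep_lyndon_word (exponent_mset m)"

lemma bij_betw_lyndon_monomial:
  "bij_betw lyndon_monomial UNIV {M :: 'a::linorder list multiset. \<forall>x \<in># M. lyndon x}"
proof (rule bij_betw_imageI)
  show "inj (lyndon_monomial :: ('a lyndon_word \<Rightarrow>\<^sub>0 nat) \<Rightarrow> _)"
  proof (rule injI)
    fix m n :: "'a lyndon_word \<Rightarrow>\<^sub>0 nat"
    assume "lyndon_monomial m = lyndon_monomial n"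
    then have "image_mset Abs_lyndon_word (lyndon_monomial m)
        = image_mset Abs_lyndon_word (lyndon_monomial n)"
      by simp
    then have "exponent_mset m = exponent_mset n"
      by (simp add: lyndon_monomial_def multiset.map_comp comp_def Rep_lyndon_word_inverse)
    then show "m = n"
      by (rule injD[OF bij_is_inj[OF bij_exponent_mset]])
  qed
  show "range lyndon_monomial = {M :: 'a list multiset. \<forall>x \<in># M. lyndon x}"
  proof safe
    fix M :: "'a list multiset"
    assume lyndon: "\<forall>x \<in># M. lyndon x"
    obtain m where "exponent_mset m = image_mset Abs_lyndon_word M"
      using bij_exponent_mset by (metis bij_pointE)
    moreover have "image_mset (\<lambda>x. Rep_lyndon_word (Abs_lyndon_word x)) M = image_mset (\<lambda>x. x) M"
      using lyndon by (intro image_mset_cong) (simp add: Abs_lyndon_word_inverse)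
    ultimately have "lyndon_monomial m = M"
      by (simp add: lyndon_monomial_def multiset.map_comp comp_def)
    then show "M \<in> range lyndon_monomial"
      by blast
  qed (use Rep_lyndon_word in \<open>auto simp: lyndon_monomial_def\<close>)
qed

definition lyndon_eval ::
  "'k::comm_ring_1 \<Rightarrow> ('a::{ab_semigroup_mult, linorder} lyndon_word, 'k) polynomial_algebra
     \<Rightarrow> ('a list \<Rightarrow>\<^sub>0 'k)" where
  "lyndon_eval l =
     lin_ext (\<lambda>m. ms_prod l (image_mset (\<lambda>x. Poly_Mapping.single x 1) (lyndon_monomial m)))"

lemma bij_lyndon_eval:
  fixes l :: "'k::linordered_field"
  shows "bij (lyndon_eval l :: ('a::{ab_semigroup_mult, linorder} lyndon_word, 'k) polynomial_algebra \<Rightarrow> _)"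
  unfolding lyndon_eval_def
proof (rule bij_lin_ext_triangular)
  let ?f = "\<lambda>m :: 'a lyndon_word \<Rightarrow>\<^sub>0 nat. lyndon_concat (lyndon_monomial m)"
  let ?g = "\<lambda>m :: 'a lyndon_word \<Rightarrow>\<^sub>0 nat.
    ms_prod l (image_mset (\<lambda>x. Poly_Mapping.single x 1) (lyndon_monomial m))"
  let ?r = "measures [length, anagram_rank :: 'a list \<Rightarrow> nat]"
  show "bij ?f"
    using bij_betw_trans[OF bij_betw_lyndon_monomial bij_betw_lyndon_concat]
    by (simp add: comp_def)
  show "wf ?r"
    by simp
  show "trans ?r"
    by (auto intro!: transI)
  have lead: "leading_word (?f m) (?g m)" for m
    using bij_betw_apply[OF bij_betw_lyndon_monomial, of m]
    by (intro leading_word_ms_prod) auto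
  show "Poly_Mapping.lookup (?g m) (?f m) \<noteq> 0" for m
    using lead[of m] by (simp add: leading_word_def in_keys_iff)
  show "c = ?f m \<or> (c, ?f m) \<in> ?r" if "c \<in> Poly_Mapping.keys (?g m)" for m c
    using lead[of m] that anagram_rank_less[of c "?f m"] mset_eq_length[of c "?f m"]
    by (auto simp: leading_word_def order_le_less)
qed

lemma lyndon_eval_add: "lyndon_eval l (p + q) = lyndon_eval l p + lyndon_eval l q"
  by (simp add: lyndon_eval_def lin_ext_add)

lemma lyndon_eval_scale: "lyndon_eval l (scale c p) = scale c (lyndon_eval l p)"
  by (simp add: lyndon_eval_def lin_ext_scale)

lemma lyndon_eval_mult: "lyndon_eval l (p * q) = ms_mult l (lyndon_eval l p) (lyndon_eval l q)"
proof -
  have scale: "scale c p = Poly_Mapping.single 0 c * p"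
    for c :: 'b and p :: "('a lyndon_word, 'b) polynomial_algebra"
    unfolding scale_def by (rule mult_map_scale_conv_mult)
  have scale_mult: "scale c p * q = scale c (p * q)" "q * scale c p = scale c (q * p)"
    for c :: 'b and p q :: "('a lyndon_word, 'b) polynomial_algebra"
    unfolding scale by (simp_all only: ac_simps)
  note simps = lyndon_eval_def lin_ext_add lin_ext_scale ms_mult_simps scale_mult distrib_left
    distrib_right
  show ?thesis
  proof (induction p rule: poly_mapping_linear_induct)
    case (basis m)
    show ?case
    proof (induction q rule: poly_mapping_linear_induct)
      case (basis n)
      show ?case
        by (simp add: lyndon_eval_def mult_single lyndon_monomial_def exponent_mset_add scale_simps)
    qed (simp_all add: simps)
  qed (simp_all add: simps)
qed

theorem theorem2p3:
  fixes lam :: rat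
  shows "\<exists>\<phi> :: ('a::{ab_semigroup_mult, linorder} list \<Rightarrow>\<^sub>0 rat) \<Rightarrow> ('a lyndon_word, rat) polynomial_algebra.
           bij \<phi> \<and>
           (\<forall>x y. \<phi> (x + y) = \<phi> x + \<phi> y) \<and>
           (\<forall>c x. \<phi> (scale c x) = scale c (\<phi> x)) \<and>
           \<phi> ms_one = 1 \<and>
           (\<forall>x y. \<phi> (ms_mult lam x y) = \<phi> x * \<phi> y)"
proof -
  let ?\<psi> = "lyndon_eval lam :: ('a lyndon_word, rat) polynomial_algebra \<Rightarrow> _"
  define \<phi> where "\<phi> = inv ?\<psi>"
  have bij: "bij ?\<psi>"
    by (rule bij_lyndon_eval)
  have \<psi>\<phi>: "?\<psi> (\<phi> x) = x" for x
    using bij by (simp add: \<phi>_def bij_is_surj surj_f_inv_f)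
  have eqI: "\<phi> x = p" if "x = ?\<psi> p" for x p
    using bij that by (simp add: \<phi>_def bij_is_inj)
  have one: "?\<psi> 1 = ms_one"
    by (simp add: lyndon_eval_def lyndon_monomial_def exponent_mset_zero scale_simps flip: single_one)
  have "bij \<phi>"
    unfolding \<phi>_def using bij by (rule bij_imp_bij_inv)
  moreover have "\<phi> (x + y) = \<phi> x + \<phi> y" for x y
    by (rule eqI) (simp add: lyndon_eval_add \<psi>\<phi>)
  moreover have "\<phi> (scale c x) = scale c (\<phi> x)" for c x
    by (rule eqI) (simp add: lyndon_eval_scale \<psi>\<phi>)
  moreover have "\<phi> ms_one = 1"
    using one by (intro eqI) simp
  moreover have "\<phi> (ms_mult lam x y) = \<phi> x * \<phi> y" for x y
    by (rule eqI) (simp add: lyndon_eval_mult \<psi>\<phi>)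
  ultimately show ?thesis
    by blast
qed

end
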